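(* Let $d\ge 3$, let $\mathcal{G}(n)$ be a symmetric, (strongly) connected directed graph on $n$ nodes, and let $A=[a_{ij}]\in\mathbb{R}^{n\times n}$ be a symmetric strictly diagonally dominant weight matrix for $\mathcal{G}(n)$. Then all fixed points of $f$ that are not in the consensus set $\mathcal{C}$ are unstable, i.e. $\mathcal{F}\setminus\mathcal{C}\subset\mathcal{U}$.
   Context: A directed graph $\mathcal{G}(n)=(\mathcal{V}(n),\mathcal{E})$ has nodes $\mathcal{V}(n)=\{1,\dots,n\}$ and edges $\mathcal{E}\subset \mathcal{V}(n)\times\mathcal{V}(n)$. It is strongly connected if there is a directed path between any two nodes; it is symmetric if $(i,j)\in\mathcal{E}$ implies $(j,i)\in\mathcal{E}$. A matrix $A=[a_{ij}]\in\mathbb{R}^{n\times n}$ is a weight matrix for $\mathcal{G}(n)$ if all its entries are non-negative and, for all $i\neq j$, $a_{ij}>0$ if and only if $(i,j)\in\mathcal{E}$. It is strictly diagonally dominant if $a_{ii}>\sum_{j\ne i}a_{ij}$ for all $i$. $\mathbb{S}^{d-1}$ is the Euclidean unit sphere in $\mathbb{R}^d$, and $(\mathbb{S}^{d-1})^n$ is the set of stacked vectors $x=[x_1^T,\dots,x_n^T]^T\in\mathbb{R}^{nd}$ with each $x_i\in\mathbb{S}^{d-1}$. For a strictly diagonally dominant weight matrix $A$, the map $f:(\mathbb{S}^{d-1})^n\to(\mathbb{S}^{d-1})^n$ is defined by $f(x)=[f_1(x)^T,\dots,f_n(x)^T]^T$ with $$f_i(x)=\frac{\sum_{j=1}^n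 a_{ij}x_j}{\left\|\sum_{j=1}^n a_{ij}x_j\right\|_2},$$ which is well defined (no division by zero). The set of fixed points is $\mathcal{F}=\{x\in(\mathbb{S}^{d-1})^n: f(x)=x\}$ and the consensus set is $\mathcal{C}=\{x\in(\mathbb{S}^{d-1})^n: x_1=x_2=\dots=x_n\}\subset\mathcal{F}$. For $x\in(\mathbb{S}^{d-1})^n$, $\mathcal{D}f(x)$ denotes the differential of $f$ at $x$, a linear map from the tangent space of $(\mathbb{S}^{d-1})^n$ at $x$ to the tangent space at $f(x)$; at a fixed point it is an endomorphism of the tangent space at $x$, with (complex) eigenvalues $\lambda_i(\mathcal{D}f(x))$. The set of unstable fixed points is $\mathcal{U}=\{x\in\mathcal{F}:\max_i|\lambda_i(\mathcal{D}f(x))|>1\}$. *)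

theory Defs
  imports "HOL-Analysis.Analysis"
begin

section \<open>Weighted directed graphs\<close>

definition strongly_connected :: "('n \<times> 'n) set \<Rightarrow> bool" where
  "strongly_connected E \<longleftrightarrow> (\<forall>i j. (i, j) \<in> E\<^sup>*)"

definition weight_matrix :: "('n::finite \<times> 'n) set \<Rightarrow> real^'n^'n \<Rightarrow> bool" where
  "weight_matrix E A \<longleftrightarrow>
     (\<forall>i j. A $ i $ j \<ge> 0) \<and> (\<forall>i j. i \<noteq> j \<longrightarrow> (A $ i $ j > 0 \<longleftrightarrow> (i, j) \<in> E))"

definition strictly_diagonally_dominant :: "real^'n^'n::finite \<Rightarrow> bool" where
  "strictly_diagonally_dominant A \<longleftrightarrow> (\<forall>i. A $ i $ i > (\<Sum>j\<in>UNIV - {i}. A $ i $ j))"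

section \<open>Tangent spaces, differentials and eigenvalues\<close>

text \<open>Velocities at \<open>x\<close> of curves in \<open>M\<close>; this is the tangent space when \<open>M\<close> is an
  embedded submanifold.\<close>

definition tangent_space :: "'a::real_normed_vector set \<Rightarrow> 'a \<Rightarrow> 'a set" where
  "tangent_space M x =
     {v. \<exists>\<gamma>::real \<Rightarrow> 'a. \<gamma> 0 = x \<and> (\<forall>\<^sub>F t in nhds 0. \<gamma> t \<in> M) \<and>
           (\<gamma> has_vector_derivative v) (at 0)}"

text \<open>The derivative within \<open>M\<close> is not unique on the ambient space, and
  \<^const>\<open>frechet_derivative\<close> picks an arbitrary one, but its restriction to the tangent space
  does not depend on that choice (lemma \<open>differential_eq\<close> below).\<close>

definition differential ::
    "'a::real_normed_vector set \<Rightarrow> ('a \<Rightarrow> 'b::real_normed_vector) \<Rightarrow> 'a \<Rightarrow> 'a \<Rightarrow> 'b" where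
  "differential M f x = restrict (frechet_derivative f (at x within M)) (tangent_space M x)"

text \<open>Complex eigenvalues of a real-linear endomorphism \<open>L\<close> of a real vector space \<open>T\<close>:
  \<open>u + \<i> w\<close> is an eigenvector of the complexification of \<open>L\<close>, and the two equations are the
  real and imaginary parts of \<open>L (u + \<i> w) = \<mu> (u + \<i> w)\<close>.\<close>

definition complex_eigenvalues :: "'a::real_vector set \<Rightarrow> ('a \<Rightarrow> 'a) \<Rightarrow> complex set" where
  "complex_eigenvalues T L =
     {\<mu>. \<exists>u\<in>T. \<exists>w\<in>T. (u, w) \<noteq> (0, 0) \<and>
           L u = Re \<mu> *\<^sub>R u - Im \<mu> *\<^sub>R w \<and>
           L w = Im \<mu> *\<^sub>R u + Re \<mu> *\<^sub>R w}"

lemma vector_derivative_along_curve: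
  assumes f: "(f has_derivative f') (at x within M)"
    and \<gamma>: "\<gamma> 0 = x" "\<forall>\<^sub>F t in nhds 0. \<gamma> t \<in> M" "(\<gamma> has_vector_derivative v) (at (0::real))"
  shows "((\<lambda>t. f (\<gamma> t)) has_vector_derivative f' v) (at 0)"
proof -
  obtain S where S: "open S" "0 \<in> S" "\<And>t. t \<in> S \<Longrightarrow> \<gamma> t \<in> M"
    using \<gamma>(2) unfolding eventually_nhds by blast
  have "(\<gamma> has_derivative (\<lambda>h. h *\<^sub>R v)) (at 0 within S)"
    using \<gamma>(3) has_derivative_at_withinI unfolding has_vector_derivative_def by blast
  moreover have "(f has_derivative f') (at (\<gamma> 0) within \<gamma> ` S)"
    using f \<gamma>(1) S(3) by (metis has_derivative_subset image_subsetI)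
  ultimately have "(f \<circ> \<gamma> has_derivative f' \<circ> (\<lambda>h. h *\<^sub>R v)) (at 0 within S)"
    by (rule diff_chain_within)
  then have "(f \<circ> \<gamma> has_derivative f' \<circ> (\<lambda>h. h *\<^sub>R v)) (at 0)"
    by (simp only: at_within_open[OF S(2,1)])
  moreover have "f' \<circ> (\<lambda>h. h *\<^sub>R v) = (\<lambda>h. h *\<^sub>R f' v)"
    using has_derivative_linear[OF f] by (auto simp: linear_cmul)
  ultimately show ?thesis
    by (simp add: has_vector_derivative_def comp_def)
qed

lemma differential_eq:
  assumes f: "(f has_derivative f') (at x within M)" and v: "v \<in> tangent_space M x"
  shows "differential M f x v = f' v"
proof -
  obtain \<gamma> :: "real \<Rightarrow> _" where \<gamma>: "\<gamma> 0 = x" "\<forall>\<^sub>F t in nhds 0. \<gamma> t \<in> M"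
      "(\<gamma> has_vector_derivative v) (at 0)"
    using v unfolding tangent_space_def by blast
  have "(f has_derivative frechet_derivative f (at x within M)) (at x within M)"
    using f by (metis differentiable_def frechet_derivative_works)
  from vector_derivative_along_curve[OF this \<gamma>] vector_derivative_along_curve[OF f \<gamma>]
  have "frechet_derivative f (at x within M) v = f' v"
    by (rule vector_derivative_unique_at)
  with v show ?thesis by (simp add: differential_def)
qed

section \<open>The dynamics on a product of spheres\<close>

text \<open>The stacked vector \<open>x\<close> has type \<open>real^'d^'n\<close>, with block \<open>x $ i\<close> in \<open>real^'d\<close>.\<close>

definition spheres :: "(real^'d^'n) set" where
  "spheres = {x. \<forall>i. x $ i \<in> sphere 0 1}"

text \<open>Only the values on \<^const>\<open>spheres\<close> matter below; there the denominator is nonzero if \<open>A\<close>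
  is a strictly diagonally dominant weight matrix.\<close>

definition sphere_map :: "real^'n^'n \<Rightarrow> real^'d^'n \<Rightarrow> real^'d^'n::finite" where
  "sphere_map A x =
     (\<chi> i. (\<Sum>j\<in>UNIV. A $ i $ j *\<^sub>R x $ j) /\<^sub>R norm (\<Sum>j\<in>UNIV. A $ i $ j *\<^sub>R x $ j))"

definition fixed_points :: "real^'n^'n \<Rightarrow> (real^'d^'n::finite) set" where
  "fixed_points A = {x \<in> spheres. sphere_map A x = x}"

definition consensus_set :: "(real^'d^'n) set" where
  "consensus_set = {x \<in> spheres. \<forall>i j. x $ i = x $ j}"

definition unstable_fixed_points :: "real^'n^'n \<Rightarrow> (real^'d^'n::finite) set" where
  "unstable_fixed_points A =
     {x \<in> fixed_points A.
        \<exists>\<mu>\<in> complex_eigenvalues (tangent_space spheres x) (differential spheres (sphere_map A) x).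
          cmod \<mu> > 1}"

lemma tangent_space_spheres:
  fixes x :: "real^'d^'n"
  assumes x: "x \<in> spheres"
  shows "tangent_space spheres x = {v. \<forall>i. x $ i \<bullet> v $ i = 0}"
proof (intro subset_antisym subsetI CollectI allI)
  fix v i assume "v \<in> tangent_space spheres x"
  then obtain \<gamma> :: "real \<Rightarrow> real^'d^'n" where \<gamma>: "\<gamma> 0 = x" "\<forall>\<^sub>F t in nhds 0. \<gamma> t \<in> spheres"
      "(\<gamma> has_vector_derivative v) (at 0)"
    unfolding tangent_space_def by blast
  let ?f = "\<lambda>y::real^'d^'n. y $ i \<bullet> y $ i"
  have "(?f has_derivative (\<lambda>h. x $ i \<bullet> h $ i + h $ i \<bullet> x $ i)) (at x within spheres)"
    by (intro derivative_intros bounded_linear_imp_has_derivative bounded_linear_vec_nth)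
  from vector_derivative_along_curve[OF this \<gamma>]
  have 1: "((\<lambda>t. ?f (\<gamma> t)) has_vector_derivative x $ i \<bullet> v $ i + v $ i \<bullet> x $ i) (at 0)" .
  have "(?f has_derivative (\<lambda>h. 0)) (at x within spheres)"
  proof (rule has_derivative_transform[where f = "\<lambda>_. 1"])
    show "?f y = 1" if "y \<in> spheres" for y
      using that by (simp add: spheres_def dot_square_norm)
  qed (use x in auto)
  from vector_derivative_along_curve[OF this \<gamma>]
  have "((\<lambda>t. ?f (\<gamma> t)) has_vector_derivative 0) (at 0)" .
  with 1 have "x $ i \<bullet> v $ i + v $ i \<bullet> x $ i = 0"
    by (rule vector_derivative_unique_at)
  then show "x $ i \<bullet> v $ i = 0" by (simp add: inner_commute)
next
  fix v assume "v \<in> {v. \<forall>i. x $ i \<bullet> v $ i = 0}"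
  then have orth: "x $ i \<bullet> v $ i = 0" for i by simp
  define \<gamma> where "\<gamma> t = (\<chi> i. cos (t * norm (v $ i)) *\<^sub>R x $ i + sin (t * norm (v $ i)) *\<^sub>R sgn (v $ i))"
    for t :: real
  have "\<gamma> t \<in> spheres" for t
  proof -
    have "norm (\<gamma> t $ i) = 1" for i
    proof (cases "v $ i = 0")
      case True
      with x show ?thesis by (simp add: \<gamma>_def spheres_def)
    next
      case False
      have "x $ i \<bullet> x $ i = 1" using x by (simp add: spheres_def dot_square_norm)
      moreover have "sgn (v $ i) \<bullet> sgn (v $ i) = 1"
        using False by (simp add: dot_square_norm norm_sgn)
      moreover have "x $ i \<bullet> sgn (v $ i) = 0" by (simp add: sgn_div_norm orth)
      ultimately have "\<gamma> t $ i \<bullet> \<gamma> t $ i = 1"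
        by (simp add: \<gamma>_def inner_left_distrib inner_right_distrib inner_commute
            flip: power2_eq_square)
      then show ?thesis by (simp add: norm_eq_sqrt_inner)
    qed
    then show ?thesis by (simp add: spheres_def)
  qed
  moreover have "\<gamma> 0 = x" by (simp add: \<gamma>_def vec_eq_iff)
  moreover have "(\<gamma> has_vector_derivative v) (at 0)"
  proof -
    have comp: "((\<lambda>t. \<gamma> t $ i) has_derivative (\<lambda>h. (h *\<^sub>R v) $ i)) (at 0)" for i
    proof -
      have sgn: "norm (v $ i) *\<^sub>R sgn (v $ i) = v $ i"
        by (cases "v $ i = 0") (simp_all add: sgn_div_norm)
      have c: "((\<lambda>t. cos (t * norm (v $ i))) has_derivative (\<lambda>h. 0)) (at 0)"
        and s: "((\<lambda>t. sin (t * norm (v $ i))) has_derivative (\<lambda>h. h * norm (v $ i))) (at 0)"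
        by (auto intro!: derivative_eq_intros)
      have "((\<lambda>t. cos (t * norm (v $ i)) *\<^sub>R x $ i + sin (t * norm (v $ i)) *\<^sub>R sgn (v $ i))
          has_derivative (\<lambda>h. 0 *\<^sub>R x $ i + (h * norm (v $ i)) *\<^sub>R sgn (v $ i))) (at 0)"
        by (intro has_derivative_add has_derivative_scaleR_left c s)
      moreover have "(h * norm (v $ i)) *\<^sub>R sgn (v $ i) = h *\<^sub>R v $ i" for h
        using sgn by (metis scaleR_scaleR)
      ultimately show ?thesis by (simp add: \<gamma>_def)
    qed
    have "((\<lambda>t. \<gamma> t \<bullet> b) has_derivative (\<lambda>h. (h *\<^sub>R v) \<bullet> b)) (at 0)" if b: "b \<in> Basis" for b
    proof -
      obtain i u where iu: "b = axis i u"
        using b by (auto simp: Basis_vec_def[where 'a = "real^'d"])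
      show ?thesis
        unfolding iu inner_axis by (rule has_derivative_inner_left[OF comp])
    qed
    then have "(\<gamma> has_derivative (\<lambda>h. h *\<^sub>R v)) (at 0)"
      using has_derivative_componentwise_within[of \<gamma> "\<lambda>h. h *\<^sub>R v" 0 UNIV] by simp
    then show ?thesis
      by (simp only: has_vector_derivative_def)
  qed
  ultimately show "v \<in> tangent_space spheres x"
    unfolding tangent_space_def by (auto intro!: exI[of _ \<gamma>])
qed

end

theory Submission
  imports Defs
begin

text \<open>At a fixed point \<open>x\<close> write \<open>\<sigma>\<^sub>i = \<Sum>\<^sub>j a\<^sub>i\<^sub>j x\<^sub>i \<bullet> x\<^sub>j > 0\<close>, so that \<open>\<Sum>\<^sub>j a\<^sub>i\<^sub>j x\<^sub>j = \<sigma>\<^sub>i x\<^sub>i\<close>. With \<open>P\<^sub>i\<close>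
  the orthogonal projection along \<open>x\<^sub>i\<close>, the differential is \<open>v \<mapsto> (\<sigma>\<^sub>i\<^sup>-\<^sup>1 P\<^sub>i (\<Sum>\<^sub>j a\<^sub>i\<^sub>j v\<^sub>j))\<^sub>i\<close>, which is
  self-adjoint on the tangent space for the inner product \<open>\<Sum>\<^sub>i \<sigma>\<^sub>i u\<^sub>i \<bullet> v\<^sub>i\<close>. By the Rayleigh
  principle it has a real eigenvalue above \<open>1\<close> as soon as some tangent vector satisfies
  \<open>\<Sum>\<^sub>i\<^sub>j a\<^sub>i\<^sub>j v\<^sub>i \<bullet> v\<^sub>j > \<Sum>\<^sub>i \<sigma>\<^sub>i |v\<^sub>i|\<^sup>2\<close>. For \<open>v\<^sub>i = P\<^sub>i y\<close>, summing the difference of the two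
  sides over \<open>y\<close> in an orthonormal basis gives
  \<open>\<Sum>\<^sub>i\<^sub>j a\<^sub>i\<^sub>j (1 - c\<^sub>i\<^sub>j) (d - 2 - c\<^sub>i\<^sub>j)\<close> with \<open>c\<^sub>i\<^sub>j = x\<^sub>i \<bullet> x\<^sub>j\<close>, and for \<open>d \<ge> 3\<close> this is positive unless
  all \<open>x\<^sub>i\<close> coincide. Hence some \<open>y\<close> works.\<close>

section \<open>Derivatives of block vectors and of normalization\<close>

lemma has_derivative_vec_componentwise:
  fixes f :: "'a::real_normed_vector \<Rightarrow> ('b::euclidean_space)^'n"
  assumes "\<And>i. ((\<lambda>x. f x $ i) has_derivative (\<lambda>h. f' h $ i)) (at x within S)"
  shows "(f has_derivative f') (at x within S)"
proof -
  have "((\<lambda>x. f x \<bullet> b) has_derivative (\<lambda>h. f' h \<bullet> b)) (at x within S)" if "b \<in> Basis" for b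
  proof -
    obtain i u where "b = axis i u"
      using \<open>b \<in> Basis\<close> by (auto simp: Basis_vec_def)
    then show ?thesis
      using has_derivative_inner_left[OF assms[of i], of u] by (simp add: inner_axis)
  qed
  then show ?thesis
    using has_derivative_componentwise_within[of f f' x S] by blast
qed

text \<open>A radial perturbation leaves the direction unchanged, so only the component of
  \<open>h\<close> orthogonal to \<open>z\<close> survives, scaled by the inverse norm.\<close>

lemma has_derivative_normalize:
  fixes z :: "'a::euclidean_space"
  assumes "z \<noteq> 0"
  shows "((\<lambda>z. z /\<^sub>R norm z) has_derivative
      (\<lambda>h. (h - (sgn z \<bullet> h) *\<^sub>R sgn z) /\<^sub>R norm z)) (at z)"
proof -
  have "((\<lambda>z. z /\<^sub>R norm z) has_derivative
      (\<lambda>h. inverse (norm z) *\<^sub>R h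
        + (- (inverse (norm z) * (h \<bullet> sgn z) * inverse (norm z))) *\<^sub>R z)) (at z)"
    using assms by (intro has_derivative_scaleR Deriv.has_derivative_inverse has_derivative_norm
        has_derivative_ident) auto
  moreover have "inverse (norm z) *\<^sub>R h
        + (- (inverse (norm z) * (h \<bullet> sgn z) * inverse (norm z))) *\<^sub>R z
      = (h - (sgn z \<bullet> h) *\<^sub>R sgn z) /\<^sub>R norm z" for h
    by (simp add: sgn_div_norm inner_commute algebra_simps)
  ultimately show ?thesis by simp
qed

section \<open>Rayleigh principle for a pair of symmetric operators\<close>

text \<open>By compactness the Rayleigh quotient of \<open>B\<close> relative to \<open>D\<close>
  attains its maximum over nonzero vectors of \<open>T\<close>; the maximum exceeds 1 because of
  \<open>v\<close>, and a maximizer is a critical point. Since \<open>B\<close> may lead out of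
  \<open>T\<close>, the eigenvalue equation is tested only against \<open>T\<close>.\<close>

lemma generalized_eigenvector_exists:
  fixes B D :: "'a::euclidean_space \<Rightarrow> 'a"
  assumes T: "subspace T" and B: "linear B" and D: "linear D"
    and symB: "\<And>u v. u \<bullet> B v = B u \<bullet> v" and symD: "\<And>u v. u \<bullet> D v = D u \<bullet> v"
    and posD: "\<And>v. v \<noteq> 0 \<Longrightarrow> v \<bullet> D v > 0"
    and v: "v \<in> T" "v \<bullet> B v > v \<bullet> D v"
  obtains \<mu> u where "\<mu> > 1" "u \<in> T" "u \<noteq> 0" "\<And>w. w \<in> T \<Longrightarrow> w \<bullet> (B u - \<mu> *\<^sub>R D u) = 0"
proof -
  define R where "R v = (v \<bullet> B v) / (v \<bullet> D v)" for v
  have v0: "v \<noteq> 0" using v by (auto simp: linear_0[OF B] linear_0[OF D])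
  let ?K = "T \<inter> sphere 0 1"
  have cont: "continuous_on ?K R"
  proof -
    have "v \<bullet> D v \<noteq> 0" if "v \<in> ?K" for v
    proof -
      have "v \<noteq> 0" using that by auto
      from posD[OF this] show ?thesis by simp
    qed
    moreover have "continuous_on ?K B" "continuous_on ?K D"
      using B D by (simp_all add: linear_continuous_on linear_conv_bounded_linear)
    ultimately show ?thesis
      unfolding R_def by (intro continuous_intros) auto
  qed
  have sgn_K: "sgn w \<in> ?K" if "w \<in> T" "w \<noteq> 0" for w
    using that T by (simp add: sgn_div_norm subspace_scale)
  have R_sgn: "R (sgn w) = R w" if "w \<noteq> 0" for w
    using that by (simp add: R_def sgn_div_norm linear_cmul[OF B] linear_cmul[OF D])
  have "compact ?K"
    using closed_subspace[OF T] by (simp add: closed_Int_compact)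
  then obtain u where u: "u \<in> ?K" and max: "\<And>w. w \<in> ?K \<Longrightarrow> R w \<le> R u"
    using continuous_attains_sup[OF _ _ cont] sgn_K[OF v(1) v0] by blast
  define \<mu> where "\<mu> = R u"
  have u0: "u \<noteq> 0" using u by auto
  have "R v > 1" using v posD[OF v0] by (simp add: R_def)
  moreover have le: "R w \<le> \<mu>" if "w \<in> T" "w \<noteq> 0" for w
    using max[OF sgn_K[OF that]] R_sgn[OF that(2)] by (simp add: \<mu>_def)
  ultimately have "\<mu> > 1" using v(1) v0 by force
  \<comment> \<open>Clearing the denominator turns maximality of the quotient at \<open>u\<close>
    into maximality of a quadratic form, with value 0 at \<open>u\<close>.\<close>
  define g where "g w = w \<bullet> (B w - \<mu> *\<^sub>R D w)" for w
  have g_nonpos: "g w \<le> 0" if "w \<in> T" for w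
    using le[OF that] posD[of w]
    by (cases "w = 0") (auto simp: g_def R_def inner_diff_right field_simps)
  have g_u: "g u = 0"
    using posD[OF u0] by (simp add: g_def \<mu>_def R_def inner_diff_right)
  have "w \<bullet> (B u - \<mu> *\<^sub>R D u) = 0" if w: "w \<in> T" for w
  proof -
    define b where "b = w \<bullet> (B u - \<mu> *\<^sub>R D u)"
    have "g (u + t *\<^sub>R w) = g u + 2 * t * b + t\<^sup>2 * g w" for t
      using symB[of u w] symD[of u w]
      by (simp add: g_def b_def linear_add[OF B] linear_add[OF D] linear_cmul[OF B]
          linear_cmul[OF D] algebra_simps inner_commute power2_eq_square)
    then have quad: "2 * t * b + t\<^sup>2 * g w \<le> 0" for t
      using g_nonpos[of "u + t *\<^sub>R w"] g_u u w T by (simp add: subspace_add subspace_scale)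
    \<comment> \<open>The linear term must vanish. The step \<open>t = b / s\<close> makes the
      quadratic positive unless \<open>b = 0\<close>; the summand 1 keeps \<open>s\<close> positive
      even when \<open>g w = 0\<close>.\<close>
    define s where "s = 1 - g w"
    then have "g w = 1 - s" by simp
    with quad[of "b / s"] have "2 * (b / s) * b + (b / s)\<^sup>2 * (1 - s) \<le> 0" by simp
    moreover have "s > 0" using g_nonpos[OF w] by (simp add: s_def)
    then have "2 * (b / s) * b + (b / s)\<^sup>2 * (1 - s) = b\<^sup>2 * (s + 1) / s\<^sup>2"
      by (simp add: field_simps power2_eq_square)
    ultimately have "b\<^sup>2 * (s + 1) \<le> 0"
      using \<open>s > 0\<close> by (simp add: divide_le_0_iff)
    then have "b = 0"
      using \<open>s > 0\<close> by (simp add: mult_le_0_iff)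
    then show ?thesis by (simp add: b_def)
  qed
  with \<open>\<mu> > 1\<close> u u0 that show thesis by blast
qed

text \<open>The sum is the trace of the product of the projections orthogonal to \<open>p\<close> and to \<open>q\<close>.\<close>

lemma sum_Basis_inner_projections:
  fixes p q :: "'a::euclidean_space"
  assumes "norm p = 1" "norm q = 1"
  shows "(\<Sum>y\<in>Basis. (y - (p \<bullet> y) *\<^sub>R p) \<bullet> (y - (q \<bullet> y) *\<^sub>R q)) = real DIM('a) - 2 + (p \<bullet> q)\<^sup>2"
proof -
  have "(y - (p \<bullet> y) *\<^sub>R p) \<bullet> (y - (q \<bullet> y) *\<^sub>R q)
      = y \<bullet> y - (p \<bullet> y) * (p \<bullet> y) - (q \<bullet> y) * (q \<bullet> y) + (p \<bullet> q) * ((p \<bullet> y) * (q \<bullet> y))" for y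
    by (simp add: algebra_simps inner_commute)
  then have "(\<Sum>y\<in>Basis. (y - (p \<bullet> y) *\<^sub>R p) \<bullet> (y - (q \<bullet> y) *\<^sub>R q))
      = DIM('a) - p \<bullet> p - q \<bullet> q + (p \<bullet> q) * (p \<bullet> q)"
    by (simp only: sum.distrib sum_subtractf sum_distrib_left[symmetric]
        euclidean_inner[of p p] euclidean_inner[of q q] euclidean_inner[of p q])
      simp
  with assms show ?thesis by (simp add: dot_square_norm power2_eq_square)
qed

text \<open>A function that agrees across every edge is constant along every path.\<close>

lemma strongly_connected_edge_neq:
  assumes "strongly_connected E" "f i \<noteq> f j"
  obtains k l where "(k, l) \<in> E" "f k \<noteq> f l"
proof -
  have "(i, j) \<in> E\<^sup>*" using assms(1) by (simp add: strongly_connected_def)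
  then have "f i = f j" if "\<And>k l. (k, l) \<in> E \<Longrightarrow> f k = f l"
    using that by induction auto
  with assms(2) that show thesis by blast
qed

section \<open>The sphere map and its differential at a fixed point\<close>

abbreviation weighted_sum :: "real^'n^'n \<Rightarrow> 'n \<Rightarrow> 'a::real_vector^'n \<Rightarrow> 'a" where
  "weighted_sum A i x \<equiv> (\<Sum>j\<in>UNIV. A $ i $ j *\<^sub>R x $ j)"

text \<open>Chain rule for a linear map followed by normalization. At a fixed point the direction of
  the weighted sum is \<open>x $ i\<close> itself, so the projection is the one along
  \<open>x $ i\<close>.\<close>

lemma has_derivative_sphere_map:
  fixes x :: "real^'d^'n::finite"
  assumes "\<And>i. weighted_sum A i x \<noteq> 0" and fixed: "sphere_map A x = x"
  shows "(sphere_map A has_derivative (\<lambda>h. \<chi> i. (weighted_sum A i h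
      - (x $ i \<bullet> weighted_sum A i h) *\<^sub>R x $ i) /\<^sub>R norm (weighted_sum A i x))) (at x within S)"
proof (rule has_derivative_vec_componentwise)
  fix i
  have sgn: "sgn (weighted_sum A i x) = x $ i"
    using arg_cong[OF fixed, of "\<lambda>y. y $ i"] by (simp add: sphere_map_def sgn_div_norm)
  have "(weighted_sum A i has_derivative weighted_sum A i) (at x within S)"
    by (intro derivative_intros bounded_linear_imp_has_derivative bounded_linear_vec_nth)
  from has_derivative_compose[OF this has_derivative_normalize[OF assms(1)]]
  show "((\<lambda>x. sphere_map A x $ i) has_derivative (\<lambda>h. (\<chi> i. (weighted_sum A i h
      - (x $ i \<bullet> weighted_sum A i h) *\<^sub>R x $ i) /\<^sub>R norm (weighted_sum A i x)) $ i))
      (at x within S)"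
    by (simp add: sgn sphere_map_def)
qed

text \<open>By the triangle inequality the off-diagonal terms together are shorter than the diagonal
  term and cannot cancel it.\<close>

lemma weighted_sum_nonzero:
  fixes x :: "real^'d^'n::finite"
  assumes A: "weight_matrix E A" "strictly_diagonally_dominant A" and x: "x \<in> spheres"
  shows "weighted_sum A i x \<noteq> 0"
proof
  assume 0: "weighted_sum A i x = 0"
  have A_nonneg: "A $ i $ j \<ge> 0" for j
    using A(1) by (simp add: weight_matrix_def)
  have unit: "norm (x $ j) = 1" for j
    using x by (simp add: spheres_def)
  have "weighted_sum A i x = A $ i $ i *\<^sub>R x $ i + (\<Sum>j\<in>UNIV - {i}. A $ i $ j *\<^sub>R x $ j)"
    by (rule sum.remove) simp_all
  with 0 have "A $ i $ i *\<^sub>R x $ i = - (\<Sum>j\<in>UNIV - {i}. A $ i $ j *\<^sub>R x $ j)"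
    by (simp only: eq_neg_iff_add_eq_0)
  then have "norm (A $ i $ i *\<^sub>R x $ i) = norm (\<Sum>j\<in>UNIV - {i}. A $ i $ j *\<^sub>R x $ j)"
    by (simp only: norm_minus_cancel)
  also have "\<dots> \<le> (\<Sum>j\<in>UNIV - {i}. A $ i $ j)"
    by (intro sum_norm_le) (simp add: A_nonneg unit)
  also have "\<dots> < A $ i $ i"
    using A(2) by (simp add: strictly_diagonally_dominant_def)
  also have "\<dots> = norm (A $ i $ i *\<^sub>R x $ i)"
    by (simp add: A_nonneg unit)
  finally show False by simp
qed

text \<open>On the tangent space the differential is the inverse of \<open>D\<close> after
  \<open>P\<close> after \<open>B\<close>, so a solution of the generalized eigenvalue problem for
  \<open>B\<close> and \<open>D\<close> is an eigenvector of it.\<close>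

lemma unstable_if_Rayleigh_gt_1:
  fixes x :: "real^'d^'n::finite"
  assumes A: "weight_matrix E A" "strictly_diagonally_dominant A" "transpose A = A"
    and x: "x \<in> fixed_points A"
    and v: "\<And>i. x $ i \<bullet> v $ i = 0"
      "(\<Sum>i\<in>UNIV. v $ i \<bullet> weighted_sum A i v)
        > (\<Sum>i\<in>UNIV. norm (weighted_sum A i x) * (v $ i \<bullet> v $ i))"
  shows "x \<in> unstable_fixed_points A"
proof -
  define \<sigma> where "\<sigma> i = norm (weighted_sum A i x)" for i
  have xs: "x \<in> spheres" and fixed: "sphere_map A x = x"
    using x by (auto simp: fixed_points_def)
  note nz = weighted_sum_nonzero[OF A(1,2) xs]
  have \<sigma>: "\<sigma> i > 0" for i using nz by (simp add: \<sigma>_def)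
  note inner_blocks = inner_vec_def[where 'a = "real^'d" and 'b = 'n]
  have sym: "A $ i $ j = A $ j $ i" for i j
    using A(3) by (metis transpose_def vec_lambda_beta)
  have unit: "x $ i \<bullet> x $ i = 1" for i
    using xs by (simp add: spheres_def dot_square_norm)
  define T where "T = {v::real^'d^'n. \<forall>i. x $ i \<bullet> v $ i = 0}"
  define B where "B v = (\<chi> i. weighted_sum A i v)" for v :: "real^'d^'n"
  define D where "D v = (\<chi> i. \<sigma> i *\<^sub>R v $ i)" for v :: "real^'d^'n"
  define P where "P r = (\<chi> i. r $ i - (x $ i \<bullet> r $ i) *\<^sub>R x $ i)" for r :: "real^'d^'n"
  have T: "tangent_space spheres x = T"
    using tangent_space_spheres[OF xs] by (simp add: T_def)
  have subT: "subspace T" by (auto simp: T_def subspace_def inner_add_right)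
  have linB: "linear B" by (intro linearI)
    (simp_all add: B_def vec_eq_iff scaleR_add_right sum.distrib scaleR_sum_right mult.commute)
  have linD: "linear D" by (intro linearI)
    (simp_all add: D_def vec_eq_iff scaleR_add_right mult.commute)
  obtain \<mu> u where \<mu>: "\<mu> > 1" and u: "u \<in> T" "u \<noteq> 0"
      and orth: "\<And>w. w \<in> T \<Longrightarrow> w \<bullet> (B u - \<mu> *\<^sub>R D u) = 0"
  proof (rule generalized_eigenvector_exists[OF subT linB linD])
    show "u \<bullet> B w = B u \<bullet> w" for u w
    proof -
      have "u \<bullet> B w = (\<Sum>i\<in>UNIV. \<Sum>j\<in>UNIV. A $ i $ j * (u $ i \<bullet> w $ j))"
        by (simp add: B_def inner_blocks inner_sum_right)
      also have "\<dots> = (\<Sum>j\<in>UNIV. \<Sum>i\<in>UNIV. A $ j $ i * (u $ i \<bullet> w $ j))"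
        by (subst sum.swap) (simp add: sym)
      also have "\<dots> = B u \<bullet> w"
        by (simp add: B_def inner_blocks inner_sum_left)
      finally show ?thesis .
    qed
    show "u \<bullet> D w = D u \<bullet> w" for u w
      by (simp add: D_def inner_blocks)
    show "w \<bullet> D w > 0" if w: "w \<noteq> 0" for w
    proof -
      obtain i where "w $ i \<noteq> 0" using w by (auto simp: vec_eq_iff)
      then show ?thesis
        unfolding D_def inner_blocks using \<sigma>
        by (intro sum_pos2[of _ i]) (auto simp: less_imp_le)
    qed
    show "v \<in> T" using v(1) by (simp add: T_def)
    show "v \<bullet> B v > v \<bullet> D v" using v(2) by (simp add: B_def D_def inner_blocks \<sigma>_def)
  qed (rule that)
  \<comment> \<open>\<open>P\<close> is the orthogonal projection onto \<open>T\<close> and the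
    residual \<open>r\<close> is orthogonal to \<open>T\<close>, so \<open>P r = 0\<close>. As
    \<open>D u\<close> lies in \<open>T\<close>, this says that \<open>P (B u)\<close> equals
    \<open>D u\<close> scaled by \<mu>.\<close>
  define r where "r = B u - \<mu> *\<^sub>R D u"
  have "P r \<in> T" by (simp add: P_def T_def inner_diff_right unit)
  then have "P r \<bullet> r = 0" using orth by (simp add: r_def)
  moreover have "P r \<bullet> r = P r \<bullet> P r"
    by (simp add: P_def inner_blocks inner_diff_left inner_diff_right unit inner_commute)
  ultimately have "P r $ i = 0" for i by simp
  then have eig: "weighted_sum A i u - (x $ i \<bullet> weighted_sum A i u) *\<^sub>R x $ i
      = (\<mu> * \<sigma> i) *\<^sub>R u $ i" for i
    using u(1) by (simp add: P_def r_def B_def D_def T_def inner_diff_right algebra_simps)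
  have diff: "differential spheres (sphere_map A) x w = (\<chi> i. (weighted_sum A i w
      - (x $ i \<bullet> weighted_sum A i w) *\<^sub>R x $ i) /\<^sub>R norm (weighted_sum A i x))" if "w \<in> T" for w
    using differential_eq[OF has_derivative_sphere_map[OF nz fixed]] that T by simp
  have "differential spheres (sphere_map A) x u = \<mu> *\<^sub>R u"
  proof -
    have "differential spheres (sphere_map A) x u $ i = (\<mu> *\<^sub>R u) $ i" for i
      using \<sigma>[of i] unfolding diff[OF u(1)] by (simp only: vec_lambda_beta eig \<sigma>_def[symmetric]) simp
    then show ?thesis by (simp add: vec_eq_iff)
  qed
  \<comment> \<open>The eigenvector is real, so 0 serves as its imaginary part. The differential is
    a restricted function, so its value at 0 is computed through membership in
    \<open>T\<close>.\<close>
  moreover have "0 \<in> T" using subT by (rule subspace_0)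
  then have "differential spheres (sphere_map A) x 0 = 0"
    by (simp add: diff vec_eq_iff)
  ultimately have "complex_of_real \<mu> \<in>
      complex_eigenvalues (tangent_space spheres x) (differential spheres (sphere_map A) x)"
    unfolding complex_eigenvalues_def T using u \<open>0 \<in> T\<close>
    by - (rule CollectI, rule bexI[of _ u], rule bexI[of _ 0], simp_all)
  with x \<mu> show ?thesis
    unfolding unstable_fixed_points_def by (auto intro!: bexI[of _ "complex_of_real \<mu>"])
qed

section \<open>Averaging the second-order gap over an orthonormal basis\<close>

theorem proposition3:
  fixes E :: "('n::finite \<times> 'n) set"
    and A :: "real^'n^'n"
  assumes "CARD('d::finite) \<ge> 3"
    and "sym E"
    and "strongly_connected E"
    and "weight_matrix E A"
    and "transpose A = A"
    and "strictly_diagonally_dominant A"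
  shows "(fixed_points A :: (real^'d^'n) set) - consensus_set \<subseteq> unstable_fixed_points A"
proof
  fix x :: "real^'d^'n" assume "x \<in> fixed_points A - consensus_set"
  then have x: "x \<in> fixed_points A" and xs: "x \<in> spheres" and fixed: "sphere_map A x = x"
    and nc: "x \<notin> consensus_set"
    by (auto simp: fixed_points_def)
  have unit: "norm (x $ i) = 1" "x $ i \<bullet> x $ i = 1" for i
    using xs by (auto simp: spheres_def dot_square_norm)
  define c where "c i j = x $ i \<bullet> x $ j" for i j
  have c_le: "c i j \<le> 1" for i j
    using norm_cauchy_schwarz[of "x $ i" "x $ j"] by (simp add: c_def unit)
  have A_nonneg: "A $ i $ j \<ge> 0" for i j
    using assms(4) by (simp add: weight_matrix_def)
  obtain i0 j0 where "x $ i0 \<noteq> x $ j0"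
    using nc xs by (auto simp: consensus_set_def)
  then obtain k l where kl: "(k, l) \<in> E" "x $ k \<noteq> x $ l"
    using strongly_connected_edge_neq[OF assms(3), of "($) x" i0 j0] by blast
  then have A_kl: "A $ k $ l > 0"
    using assms(4) unfolding weight_matrix_def by metis
  have c_kl: "c k l < 1"
  proof -
    have "0 < (norm (x $ k - x $ l))\<^sup>2" using kl(2) by simp
    also have "\<dots> = 2 - 2 * c k l"
      by (simp add: power2_norm_eq_inner inner_diff_left inner_diff_right unit c_def inner_commute)
    finally show ?thesis by simp
  qed
  define \<sigma> where "\<sigma> i = norm (weighted_sum A i x)" for i
  \<comment> \<open>Pairing the fixed point equation with the unit vector \<open>x $ i\<close>
    expresses the norm by the weights, so both sums in \<open>gap\<close> below combine into one
    double sum.\<close>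
  have \<sigma>: "\<sigma> i = (\<Sum>j\<in>UNIV. A $ i $ j * c i j)" for i
  proof -
    have "weighted_sum A i x = \<sigma> i *\<^sub>R sphere_map A x $ i"
      using weighted_sum_nonzero[OF assms(4,6) xs, of i] by (simp add: sphere_map_def \<sigma>_def)
    then have "weighted_sum A i x = \<sigma> i *\<^sub>R x $ i" by (simp only: fixed)
    then have "x $ i \<bullet> weighted_sum A i x = \<sigma> i" by (simp add: unit)
    then show ?thesis by (simp add: inner_sum_right c_def)
  qed
  \<comment> \<open>The test vector moves all points toward one common direction
    \<open>y\<close>.\<close>
  define v where "v y = (\<chi> i. y - (x $ i \<bullet> y) *\<^sub>R x $ i)" for y
  define gap where "gap y = (\<Sum>i\<in>UNIV. v y $ i \<bullet> weighted_sum A i (v y))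
      - (\<Sum>i\<in>UNIV. \<sigma> i * (v y $ i \<bullet> v y $ i))" for y
  have tr: "(\<Sum>y\<in>Basis. v y $ i \<bullet> v y $ j) = real CARD('d) - 2 + (c i j)\<^sup>2" for i j
    using sum_Basis_inner_projections[OF unit(1) unit(1), of i j] by (simp add: v_def c_def)
  have gap_eq: "gap y = (\<Sum>i\<in>UNIV. \<Sum>j\<in>UNIV.
      A $ i $ j * (v y $ i \<bullet> v y $ j - c i j * (v y $ i \<bullet> v y $ i)))" for y
    by (simp add: gap_def \<sigma> inner_sum_right sum_distrib_right right_diff_distrib sum_subtractf
        mult.assoc)
  have "(\<Sum>y\<in>Basis. gap y) = (\<Sum>i\<in>UNIV. \<Sum>j\<in>UNIV. \<Sum>y\<in>Basis.
      A $ i $ j * (v y $ i \<bullet> v y $ j - c i j * (v y $ i \<bullet> v y $ i)))"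
    unfolding gap_eq by (subst sum.swap, intro sum.cong refl, rule sum.swap)
  also have "\<dots> = (\<Sum>i\<in>UNIV. \<Sum>j\<in>UNIV.
      A $ i $ j * ((1 - c i j) * (real CARD('d) - 2 - c i j)))"
  proof (intro sum.cong refl)
    fix i j
    \<comment> \<open>Writing d for the dimension and c for \<open>c i j\<close>, the diagonal trace
      is d - 1, and d - 2 + c^2 - c (d - 1) factors as (1 - c) (d - 2 - c).\<close>
    have "c i i = 1" by (simp add: c_def unit)
    then show "(\<Sum>y\<in>Basis. A $ i $ j * (v y $ i \<bullet> v y $ j - c i j * (v y $ i \<bullet> v y $ i)))
      = A $ i $ j * ((1 - c i j) * (real CARD('d) - 2 - c i j))"
      by (simp add: tr sum_subtractf algebra_simps power2_eq_square flip: sum_distrib_left)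
  qed
  also have "\<dots> > 0"
  proof -
    \<comment> \<open>Here dimension at least 3 enters: it bounds each factor below by a square, and
      the edge from \<open>k\<close> to \<open>l\<close> with distinct endpoints makes one term
      strictly positive.\<close>
    have ge: "(1 - c i j) * (real CARD('d) - 2 - c i j) \<ge> (1 - c i j) * (1 - c i j)" for i j
      using c_le[of i j] assms(1) by (intro mult_left_mono) auto
    have nonneg: "A $ i $ j * ((1 - c i j) * (real CARD('d) - 2 - c i j)) \<ge> 0" for i j
      using order_trans[OF zero_le_square ge] A_nonneg by simp
    have "(1 - c k l) * (1 - c k l) > 0" using c_kl by simp
    from mult_pos_pos[OF A_kl less_le_trans[OF this ge]]
    have "A $ k $ l * ((1 - c k l) * (real CARD('d) - 2 - c k l)) > 0" .
    then show ?thesis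
      by (intro sum_pos2[of _ k] sum_pos2[of _ l] sum_nonneg nonneg) auto
  qed
  finally obtain y where "gap y > 0"
    by (meson not_le sum_nonpos)
  then show "x \<in> unstable_fixed_points A"
    by (intro unstable_if_Rayleigh_gt_1[OF assms(4,6,5) x, of "v y"])
      (simp_all add: gap_def \<sigma>_def v_def inner_diff_right unit)
qed

end
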